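(* As $n\to\infty$, $$Q_{n,n}(z)=\begin{cases}\dfrac{(z+1)^{2n}}{z^n}\,(1+o(1)) & \text{if } z\in\mathcal{E}_1,\\[2mm] \dfrac{2^{2n}}{\sqrt{\pi n}\,(1-z)}\,(1+o(1)) & \text{if } z\in\mathcal{E}_2,\end{cases}$$ where in each case the $o(1)$ term tends to $0$ uniformly on compact subsets of the stated domain.
   Context: For nonnegative integers $n,m$ define the polynomial $Q_{n,m}(z)=\sum_{k=0}^n\binom{n+m}{k+m}z^k$ of degree $n$. Define $$\mathcal{E}_1=\left\{z\in\mathbb{C}:\left|\tfrac{(z+1)^2}{4z}\right|>1,\ |z|>1\right\},$$ $$\mathcal{E}_2=\left\{z\in\mathbb{C}:\left|\tfrac{(z+1)^2}{4z}\right|<1\right\}\cup\left\{z\in\mathbb{C}:\left|\tfrac{(z+1)^2}{4z}\right|>1,\ |z|<1\right\}.$$ *)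

theory Defs
  imports "HOL-Analysis.Analysis" "HOL-Computational_Algebra.Polynomial"
begin

definition Q :: "nat \<Rightarrow> nat \<Rightarrow> complex poly" where
  "Q n m = (\<Sum>k\<le>n. monom (of_nat ((n + m) choose (k + m))) k)"

definition E1 :: "complex set" where
  "E1 = {z. cmod ((z + 1)\<^sup>2 / (4 * z)) > 1 \<and> cmod z > 1}"

text \<open>At \<open>z = 0\<close> the modulus of \<open>(z + 1)\<^sup>2 / (4 * z)\<close> is read as infinite, so the origin
  belongs to the second set; this is spelled out because HOL sets \<open>x / 0 = 0\<close>.\<close>

definition E2 :: "complex set" where
  "E2 = {z. z \<noteq> 0 \<and> cmod ((z + 1)\<^sup>2 / (4 * z)) < 1}
      \<union> {z. (z = 0 \<or> cmod ((z + 1)\<^sup>2 / (4 * z)) > 1) \<and> cmod z < 1}"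

end

theory Submission
  imports Defs "HOL-Real_Asymp.Real_Asymp"
begin

text \<open>
  Write \<open>w = (z + 1)\<^sup>2 / (4 z)\<close> and let \<open>1 + e\<^sub>n(z)\<close> be \<open>(1 - z) Q\<^sub>n\<^sub>,\<^sub>n(z)\<close> divided by the central
  binomial coefficient. By Wallis' product it suffices on the second set that \<open>e\<^sub>n \<rightarrow> 0\<close>. For
  \<open>\<bar>z\<bar> < 1\<close> this is Abel summation, the coefficients being nearly constant: their consecutive
  ratios are \<open>1 - O(k / n)\<close>. For \<open>\<bar>w\<bar> < 1\<close> Pascal's rule yields the asymptotically contracting
  recurrence \<open>(2n + 1) e\<^sub>n\<^sub>+\<^sub>1 = (2n + 2) w e\<^sub>n + (1 + z) / 2\<close>, so that \<open>n e\<^sub>n\<close> stays bounded. On the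
  first set the symmetry \<open>z \<mapsto> 1 / z\<close> of the full binomial sum gives
  \<open>Q\<^sub>n\<^sub>,\<^sub>n(z) = (z + 1)\<^sup>2\<^sup>n / z\<^sup>n - Q\<^sub>n\<^sub>,\<^sub>n(1 / z) + (2n choose n)\<close>, where the last two terms are
  \<open>O(4\<^sup>n)\<close> because \<open>\<bar>1 / z\<bar> < 1\<close>, hence negligible against \<open>(4 w)\<^sup>n\<close>.
\<close>

section \<open>Binomial identities, recurrence in \<open>n\<close>, and the symmetry under
  \<open>1 / z\<close>\<close>

lemma poly_Q: "poly (Q n n) z = (\<Sum>k\<le>n. of_nat (2 * n choose (n + k)) * z ^ k)"
  by (simp add: Q_def poly_sum poly_monom mult_2 add.commute)

lemma sum_shift_Suc:
  fixes f :: "nat \<Rightarrow> 'a::ab_group_add"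
  assumes "f (Suc n) = 0"
  shows "(\<Sum>k\<le>n. f (Suc k)) = (\<Sum>k\<le>n. f k) - f 0"
  using sum.atMost_Suc_shift[of f n] sum.atMost_Suc[of f n] assms by simp

text \<open>The ratio of consecutive coefficients, cleared of denominators. Real subtraction keeps
  it valid for \<open>k > n\<close>, where both binomials vanish.\<close>

lemma binomial_step:
  "real (n + k + 1) * real (2 * n choose (n + k + 1)) = (real n - real k) * real (2 * n choose (n + k))"
proof (cases "k \<le> n")
  case True
  have "Suc (n + k) * (2 * n choose Suc (n + k)) = (2 * n - (n + k)) * (2 * n choose (n + k))"
    by (metis binomial_absorption binomial_absorb_comp)
  then have "real (Suc (n + k) * (2 * n choose Suc (n + k))) = real ((2 * n - (n + k)) * (2 * n choose (n + k)))"
    by (rule arg_cong)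
  then show ?thesis using True by (simp add: of_nat_diff algebra_simps)
qed (simp add: binomial_eq_0)

lemma central_binomial_Suc:
  "2 * Suc n choose Suc n = 2 * (2 * n choose n) + 2 * (2 * n choose (n + 1))"
proof (cases n)
  case (Suc m)
  then show ?thesis using binomial_symmetric[of "Suc n" "2 * n"] by simp
qed simp

lemma central_binomial_Suc_real:
  "(real n + 1) * real (2 * Suc n choose Suc n) = 2 * (2 * real n + 1) * real (2 * n choose n)"
  using binomial_step[of n 0] unfolding central_binomial_Suc by (simp add: algebra_simps)

text \<open>Pascal's rule applied twice convolves the coefficients with 1, 2, 1, which is
  multiplication by \<open>(z + 1)^2 / z\<close>. Only the truncation at index 0 disturbs this: the
  product has a spurious \<open>1 / z\<close> term, and its constant term lacks the contribution of
  index -1, which by symmetry equals that of index 1.\<close>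

lemma poly_Q_Suc:
  "z * poly (Q (Suc n) (Suc n)) z = (z + 1)\<^sup>2 * poly (Q n n) z - of_nat (2 * n choose n)
     + z * of_nat (2 * n choose (n + 1))"
proof -
  define b :: "nat \<Rightarrow> complex" where "b k = of_nat (2 * n choose (n + k))" for k
  define S where "S = (\<Sum>k\<le>n. b k * z ^ k)"
  have b0: "b (Suc n) = 0" "b (Suc (Suc n)) = 0" by (simp_all add: b_def binomial_eq_0)
  have s1: "(\<Sum>k\<le>n. b (Suc k) * z ^ Suc k) = S - b 0"
    using sum_shift_Suc[of "\<lambda>k. b k * z ^ k" n] b0 by (simp add: S_def)
  have s2: "(\<Sum>k\<le>n. b (Suc (Suc k)) * z ^ Suc (Suc k)) = S - b 0 - b 1 * z"
    using sum_shift_Suc[of "\<lambda>k. b (Suc k) * z ^ Suc k" n] b0 s1 by simp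
  have c0: "of_nat (2 * Suc n choose (Suc n + 0)) = 2 * b 0 + 2 * b 1"
    unfolding add_0_right central_binomial_Suc by (simp add: b_def)
  have c: "of_nat (2 * Suc n choose (Suc n + Suc k)) = b (Suc (Suc k)) + 2 * b (Suc k) + b k" for k
    by (simp add: b_def)
  have "z * poly (Q (Suc n) (Suc n)) z = z * (2 * b 0 + 2 * b 1) +
      z * (\<Sum>k\<le>n. (b (Suc (Suc k)) + 2 * b (Suc k) + b k) * z ^ Suc k)"
    unfolding poly_Q sum.atMost_Suc_shift c c0 by (simp add: algebra_simps)
  also have "z * (\<Sum>k\<le>n. (b (Suc (Suc k)) + 2 * b (Suc k) + b k) * z ^ Suc k) =
      (\<Sum>k\<le>n. b (Suc (Suc k)) * z ^ Suc (Suc k)) + 2 * z * (\<Sum>k\<le>n. b (Suc k) * z ^ Suc k) + z\<^sup>2 * S"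
    by (simp add: S_def sum_distrib_left sum.distrib algebra_simps power2_eq_square)
  finally have "z * poly (Q (Suc n) (Suc n)) z = (z + 1)\<^sup>2 * S - b 0 + z * b 1"
    unfolding s1 s2 by (simp add: algebra_simps power2_eq_square)
  then show ?thesis by (simp add: poly_Q S_def b_def)
qed

text \<open>The left side is the full Laurent sum over indices from \<open>-n\<close> to
  \<open>n\<close>, the central term being counted twice and subtracted once. In the induction the
  boundary terms of \<open>poly_Q_Suc\<close> at \<open>z\<close> and \<open>1 / z\<close> combine
  with the new central coefficient: those in \<open>B1\<close> cancel, those in \<open>B\<close> add
  up to \<open>-(z + 1)^2 B\<close>.\<close>

lemma poly_Q_inverse:
  assumes "z \<noteq> 0"
  shows "poly (Q n n) z + poly (Q n n) (1 / z) - of_nat (2 * n choose n) = (z + 1) ^ (2 * n) / z ^ n"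
proof (induction n)
  case (Suc n)
  define B where "B = (of_nat (2 * n choose n) :: complex)"
  define B1 where "B1 = (of_nat (2 * n choose (n + 1)) :: complex)"
  have "z * poly (Q (Suc n) (Suc n)) (1 / z)
      = z\<^sup>2 * ((1 / z) * poly (Q (Suc n) (Suc n)) (1 / z))"
    using assms by (simp add: power2_eq_square)
  also have "\<dots> = (z + 1)\<^sup>2 * poly (Q n n) (1 / z) - z\<^sup>2 * B + z * B1"
    unfolding poly_Q_Suc B_def B1_def using assms by (simp add: field_simps power2_eq_square)
  finally have i: "z * poly (Q (Suc n) (Suc n)) (1 / z) = \<dots>" .
  have B': "of_nat (2 * Suc n choose Suc n) = 2 * B + 2 * B1"
    unfolding central_binomial_Suc by (simp add: B_def B1_def)
  have "z * (poly (Q (Suc n) (Suc n)) z + poly (Q (Suc n) (Suc n)) (1 / z) - of_nat (2 * Suc n choose Suc n))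
     = (z + 1)\<^sup>2 * (poly (Q n n) z + poly (Q n n) (1 / z) - B)"
    unfolding distrib_left right_diff_distrib i poly_Q_Suc B' B_def[symmetric] B1_def[symmetric]
    by (simp add: algebra_simps power2_eq_square)
  also have "\<dots> = (z + 1)\<^sup>2 * ((z + 1) ^ (2 * n) / z ^ n)"
    unfolding B_def Suc.IH ..
  finally show ?case using assms
    by (simp add: field_simps power2_eq_square del: binomial_Suc_Suc mult_Suc_right)
qed (simp add: poly_Q)

section \<open>Relative error against the geometric series\<close>

text \<open>Replacing every coefficient by the central one and letting the sum run to infinity gives
  the central binomial coefficient times \<open>1 / (1 - z)\<close>; this is the relative error of
  that approximation, continued formally beyond the unit disc.\<close>

definition err :: "nat \<Rightarrow> complex \<Rightarrow> complex" where
  "err n z = (1 - z) * poly (Q n n) z / of_nat (2 * n choose n) - 1"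

lemma err_Suc:
  assumes "z \<noteq> 0"
  shows "err (Suc n) z =
    (of_nat (2 * n + 2) * ((z + 1)\<^sup>2 / (4 * z)) * err n z + (1 + z) / 2) / of_nat (2 * n + 1)"
proof -
  define B where "B = (of_nat (2 * n choose n) :: complex)"
  define B1 where "B1 = (of_nat (2 * n choose (n + 1)) :: complex)"
  define B' where "B' = (of_nat (2 * Suc n choose Suc n) :: complex)"
  define m where "m = (of_nat n :: complex)"
  define P where "P = poly (Q n n) z"
  define P' where "P' = poly (Q (Suc n) (Suc n)) z"
  have "B \<noteq> 0" by (simp add: B_def)
  have "B' \<noteq> 0" by (simp add: B'_def del: binomial_Suc_Suc mult_Suc_right)
  have m1: "m + 1 \<noteq> 0" unfolding m_def by (metis of_nat_Suc of_nat_neq_0 add.commute)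
  have m2: "2 * m + 1 \<noteq> 0" unfolding m_def
    by (metis of_nat_Suc of_nat_neq_0 add.commute of_nat_mult of_nat_numeral)
  have "of_real ((real n + 1) * real (2 * n choose (n + 1))) = (of_real (real n * real (2 * n choose n)) :: complex)"
    using binomial_step[of n 0] by (simp add: algebra_simps)
  then have B1: "B1 = m * B / (m + 1)" using m1 by (simp add: field_simps B_def B1_def m_def)
  have "of_real ((real n + 1) * real (2 * Suc n choose Suc n))
      = (of_real (2 * (2 * real n + 1) * real (2 * n choose n)) :: complex)"
    by (simp only: central_binomial_Suc_real)
  then have B': "B' = 2 * (2 * m + 1) * B / (m + 1)"
    using m1 by (simp add: field_simps B_def B'_def m_def del: binomial_Suc_Suc mult_Suc_right)
  have P': "P' * z * (m + 1) = (m + 1) * ((z + 1)\<^sup>2 * P - B) + z * m * B"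
    using poly_Q_Suc[of z n] B1 m1 by (simp add: P_def P'_def B_def B1_def field_simps)
  define E where "E = (1 - z) * P / B - 1"
  define E' where "E' = (1 - z) * P' / B' - 1"
  have E: "E * B = (1 - z) * P - B" using \<open>B \<noteq> 0\<close> by (simp add: E_def field_simps)
  have E': "E' * B' = (1 - z) * P' - B'" using \<open>B' \<noteq> 0\<close> by (simp add: E'_def field_simps)
  have "(E' * (2 * (2 * m + 1) * z)) * B = (E' * B') * (m + 1) * z"
    using m1 by (simp add: B')
  also have "\<dots> = (1 - z) * (P' * z * (m + 1)) - B' * (m + 1) * z"
    unfolding E' by (simp add: algebra_simps)
  also have "\<dots> = (1 - z) * ((m + 1) * ((z + 1)\<^sup>2 * P - B) + z * m * B) - 2 * (2 * m + 1) * B * z"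
    unfolding P' using m1 by (simp add: B')
  \<comment> \<open>All multiples of \<open>m * B\<close> outside the first product cancel; hence
    the inhomogeneous term of the recurrence is only of order \<open>1 / n\<close> after division by
    \<open>2 * m + 1\<close>.\<close>
  also have "\<dots> = (m + 1) * (z + 1)\<^sup>2 * ((1 - z) * P - B) + (1 + z) * z * B"
    by (simp add: algebra_simps power2_eq_square)
  also have "\<dots> = ((m + 1) * (z + 1)\<^sup>2 * E + (1 + z) * z) * B"
    unfolding E[symmetric] by (simp add: algebra_simps)
  finally have key: "E' * (2 * (2 * m + 1) * z) = (m + 1) * (z + 1)\<^sup>2 * E + (1 + z) * z"
    using \<open>B \<noteq> 0\<close> by simp
  have "((2 * m + 2) * ((z + 1)\<^sup>2 / (4 * z)) * E + (1 + z) / 2) / (2 * m + 1)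
      = ((m + 1) * (z + 1)\<^sup>2 * E + (1 + z) * z) / (2 * (2 * m + 1) * z)"
  proof -
    have "(2 * m + 2) * ((z + 1)\<^sup>2 / (4 * z)) * E + (1 + z) / 2
        = ((m + 1) * (z + 1)\<^sup>2 * E + (1 + z) * z) / (2 * z)"
      using assms by (simp add: field_simps)
    then show ?thesis by (simp add: mult_ac)
  qed
  also have "\<dots> = E'" proof -
    have "2 * (2 * m + 1) * z \<noteq> 0" using assms m2 by (simp only: mult_eq_0_iff) simp
    then show ?thesis unfolding key[symmetric] by (rule nonzero_mult_div_cancel_right)
  qed
  finally have "(1 - z) * P' / B' - 1 =
      ((2 * m + 2) * ((z + 1)\<^sup>2 / (4 * z)) * ((1 - z) * P / B - 1) + (1 + z) / 2) / (2 * m + 1)"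
    by (simp only: E_def E'_def)
  then show ?thesis
    by (simp add: err_def P_def P'_def B_def B'_def m_def algebra_simps del: binomial_Suc_Suc mult_Suc_right)
qed

text \<open>Abel summation produces the differences \<open>b k - b (Suc k)\<close>, of size
  \<open>O(k / n)\<close> relative to \<open>b 0\<close>; the weights
  \<open>(k + 1) \<rho> ^ k\<close> then sum to at most \<open>1 / (1 - \<rho>)^2\<close>. The
  explicit constant is used again at \<open>1 / z\<close> for the outer domain.\<close>

lemma norm_err_disc:
  assumes "cmod z \<le> \<rho>" "\<rho> < 1"
  shows "cmod (err n z) \<le> 2 / (1 - \<rho>)\<^sup>2 / (real n + 1)"
proof -
  define b where "b k = real (2 * n choose (n + k))" for k
  have bpos: "b 0 > 0" by (simp add: b_def)
  have "0 \<le> \<rho>" using assms(1) norm_ge_zero order_trans by blast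
  have bb: "b k \<le> b 0" for k
    using binomial_maximum'[of n "n + k"] by (simp add: b_def)
  have bk: "\<bar>b k - b (Suc k)\<bar> \<le> 2 * real (Suc k) / (real n + 1) * b 0" for k
  proof -
    have "real (n + k + 1) * (b k - b (Suc k)) = (2 * real k + 1) * b k"
      using binomial_step[of n k] by (simp add: b_def algebra_simps)
    then have e: "b k - b (Suc k) = (2 * real k + 1) / real (n + k + 1) * b k"
      by (simp add: field_simps)
    have "\<bar>b k - b (Suc k)\<bar> = (2 * real k + 1) / real (n + k + 1) * b k"
      unfolding e by (rule abs_of_nonneg) (simp add: b_def)
    \<comment> \<open>Weakened on purpose, so that the factor \<open>Suc k\<close> matches the
      derivative of the geometric series.\<close>
    also have "\<dots> \<le> 2 * real (Suc k) / (real n + 1) * b 0"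
      by (intro mult_mono frac_le bb) (auto simp: b_def)
    finally show ?thesis .
  qed
  define S where "S = poly (Q n n) z"
  have S: "S = (\<Sum>k\<le>n. of_real (b k) * z ^ k)" by (simp add: S_def poly_Q b_def)
  \<comment> \<open>The shifted sum loses nothing at the top because
    \<open>b (Suc n) = 0\<close>.\<close>
  have "(\<Sum>k\<le>n. of_real (b (Suc k)) * z ^ Suc k) = S - of_real (b 0)"
    using sum_shift_Suc[of "\<lambda>k. of_real (b k) * z ^ k" n]
    by (simp add: S) (simp add: b_def)
  moreover have "(\<Sum>k\<le>n. of_real (b k) * z ^ Suc k) = z * S"
    by (simp add: S sum_distrib_left mult_ac)
  ultimately have "(\<Sum>k\<le>n. of_real (b k - b (Suc k)) * z ^ Suc k) = - ((1 - z) * S - of_real (b 0))"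
    by (simp add: left_diff_distrib sum_subtractf)
  then have "cmod ((1 - z) * S - of_real (b 0)) = cmod (\<Sum>k\<le>n. of_real (b k - b (Suc k)) * z ^ Suc k)"
    by (simp only: norm_minus_cancel)
  also have "\<dots> \<le> (\<Sum>k\<le>n. 2 / (real n + 1) * b 0 * (real (Suc k) * \<rho> ^ k))"
  proof (rule sum_norm_le)
    fix k
    have "cmod (z ^ Suc k) \<le> \<rho> ^ k"
      using assms \<open>0 \<le> \<rho>\<close> power_mono[of "cmod z" \<rho> "Suc k"] power_decreasing[of k "Suc k" \<rho>]
      by (simp add: norm_mult norm_power)
    then have "cmod (of_real (b k - b (Suc k)) * z ^ Suc k) \<le> (2 * real (Suc k) / (real n + 1) * b 0) * \<rho> ^ k"
      unfolding norm_mult norm_of_real by (intro mult_mono bk) (auto simp: b_def)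
    then show "cmod (of_real (b k - b (Suc k)) * z ^ Suc k) \<le> 2 / (real n + 1) * b 0 * (real (Suc k) * \<rho> ^ k)"
      by (simp add: mult_ac)
  qed
  also have "\<dots> = 2 / (real n + 1) * b 0 * (\<Sum>k\<le>n. real (Suc k) * \<rho> ^ k)"
    by (simp add: sum_distrib_left)
  also have "\<dots> \<le> 2 / (real n + 1) * b 0 * (1 / (1 - \<rho>)\<^sup>2)"
  proof (intro mult_left_mono)
    have g: "(\<lambda>k. real (Suc k) * \<rho> ^ k) sums (1 / (1 - \<rho>)\<^sup>2)"
      using geometric_deriv_sums[of \<rho>] assms \<open>0 \<le> \<rho>\<close> by simp
    show "(\<Sum>k\<le>n. real (Suc k) * \<rho> ^ k) \<le> 1 / (1 - \<rho>)\<^sup>2"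
      unfolding sums_unique[OF g] using \<open>0 \<le> \<rho>\<close>
      by (intro sum_le_suminf sums_summable[OF g]) auto
  qed (simp add: b_def)
  finally have "cmod ((1 - z) * S - of_real (b 0)) / b 0 \<le> 2 / (1 - \<rho>)\<^sup>2 / (real n + 1)"
    using bpos by (simp add: field_simps)
  moreover have "err n z = ((1 - z) * S - of_real (b 0)) / of_real (b 0)"
    by (simp add: err_def S_def b_def diff_divide_distrib)
  ultimately show ?thesis using bpos by (simp add: norm_divide)
qed

section \<open>Uniform convergence of the error on compact sets\<close>

lemma uniform_limit_zero_comparison:
  fixes f :: "nat \<Rightarrow> 'a \<Rightarrow> 'b::real_normed_vector"
  assumes "\<forall>\<^sub>F n in sequentially. \<forall>z\<in>K. norm (f n z) \<le> g n" "g \<longlonglongrightarrow> 0"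
  shows "uniform_limit K f (\<lambda>z. 0) sequentially"
proof (rule uniform_limitI)
  fix e :: real assume "e > 0"
  then have "\<forall>\<^sub>F n in sequentially. g n < e" using assms(2) by (rule order_tendstoD(2)[rotated])
  with assms(1) show "\<forall>\<^sub>F n in sequentially. \<forall>z\<in>K. dist (f n z) 0 < e"
    by eventually_elim force
qed

text \<open>The maximum is attained, so the strict bound persists with one constant; taking
  \<open>max 0\<close> makes that constant usable as a ratio or radius.\<close>

lemma compact_uniformly_less_one:
  fixes f :: "'a::topological_space \<Rightarrow> real"
  assumes "compact K" "continuous_on K f" "\<And>z. z \<in> K \<Longrightarrow> f z < 1"
  obtains \<rho> where "0 \<le> \<rho>" "\<rho> < 1" "\<And>z. z \<in> K \<Longrightarrow> f z \<le> \<rho>"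
proof (cases "K = {}")
  case True
  then show ?thesis using that[of 0] by auto
next
  case False
  then obtain x where "x \<in> K" "\<And>z. z \<in> K \<Longrightarrow> f z \<le> f x"
    using continuous_attains_sup[OF assms(1) False assms(2)] by blast
  then show ?thesis using that[of "max 0 (f x)"] assms(3)[of x] by (auto simp: le_max_iff_disj)
qed

lemma uniform_limit_err_disc:
  assumes "compact K" "\<And>z. z \<in> K \<Longrightarrow> cmod z < 1"
  shows "uniform_limit K err (\<lambda>z. 0) sequentially"
proof -
  obtain \<rho> where "\<rho> < 1" "\<And>z. z \<in> K \<Longrightarrow> cmod z \<le> \<rho>"
    using compact_uniformly_less_one[OF assms(1) continuous_on_norm_id assms(2)] by blast
  then have "\<forall>\<^sub>F n in sequentially. \<forall>z\<in>K. cmod (err n z) \<le> 2 / (1 - \<rho>)\<^sup>2 / (real n + 1)"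
    by (intro always_eventually allI ballI norm_err_disc)
  then show ?thesis by (rule uniform_limit_zero_comparison) real_asymp
qed

text \<open>By \<open>err_Suc\<close>, the quantity \<open>n * cmod (err n z)\<close> is multiplied
  at each step by a factor tending to \<open>cmod w\<close>, which is at most
  \<open>\<rho> < 1\<close>, and then receives a bounded increment. It therefore stays below a
  constant \<open>D\<close> uniform on \<open>K\<close>.\<close>

lemma uniform_limit_err_contraction:
  assumes "compact K" "\<And>z. z \<in> K \<Longrightarrow> z \<noteq> 0" "\<And>z. z \<in> K \<Longrightarrow> cmod ((z + 1)\<^sup>2 / (4 * z)) < 1"
  shows "uniform_limit K err (\<lambda>z. 0) sequentially"
proof -
  have "continuous_on K (\<lambda>z. cmod ((z + 1)\<^sup>2 / (4 * z)))"
    using assms(2) by (intro continuous_intros) auto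
  then obtain \<rho> where \<rho>: "0 \<le> \<rho>" "\<rho> < 1" "\<And>z. z \<in> K \<Longrightarrow> cmod ((z + 1)\<^sup>2 / (4 * z)) \<le> \<rho>"
    using compact_uniformly_less_one[OF assms(1)] assms(3) by blast
  have bounded: "\<exists>C. \<forall>z\<in>K. cmod (f z) \<le> C" if "continuous_on UNIV f" for f :: "complex \<Rightarrow> complex"
    using compact_imp_bounded[OF compact_continuous_image[OF continuous_on_subset[OF that] assms(1)]]
    by (auto simp: bounded_iff)
  have "\<exists>C. \<forall>z\<in>K. cmod ((1 + z) / 2) \<le> C" by (intro bounded continuous_intros) auto
  then obtain C where C: "\<And>z. z \<in> K \<Longrightarrow> cmod ((1 + z) / 2) \<le> C" by blast
  \<comment> \<open>A ratio strictly between \<open>\<rho>\<close> and 1 absorbs the rational factor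
    in \<open>n\<close>, which exceeds 1 but tends to 1.\<close>
  define \<sigma> where "\<sigma> = (1 + \<rho>) / 2"
  have \<sigma>: "\<rho> < \<sigma>" "\<sigma> < 1" using \<rho> by (auto simp: \<sigma>_def)
  have "(\<lambda>n. \<rho> * (real (n + 1) * real (2 * n + 2) / (real (2 * n + 1) * real n))) \<longlonglongrightarrow> \<rho> * 1"
    by (intro tendsto_mult tendsto_const) real_asymp
  then have "\<forall>\<^sub>F n in sequentially. \<rho> * (real (n + 1) * real (2 * n + 2) / (real (2 * n + 1) * real n)) < \<sigma>"
    using \<sigma> by (intro order_tendstoD) auto
  then obtain N0 where N0: "\<And>n. n \<ge> N0 \<Longrightarrow> \<rho> * (real (n + 1) * real (2 * n + 2) / (real (2 * n + 1) * real n)) < \<sigma>"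
    unfolding eventually_sequentially by blast
  \<comment> \<open>Starting at 1 or later avoids the factor \<open>1 / real n\<close> at
    \<open>n = 0\<close>.\<close>
  define N where "N = max 1 N0"
  have "\<exists>B. \<forall>z\<in>K. cmod (err N z) \<le> B"
    unfolding err_def by (intro bounded continuous_intros) auto
  then obtain B where B: "\<And>z. z \<in> K \<Longrightarrow> cmod (err N z) \<le> B" by blast
  \<comment> \<open>The first entry covers the base case; the second makes \<open>[0, D]\<close>
    invariant under \<open>x \<mapsto> \<sigma> x + C\<close>.\<close>
  define D where "D = max (real N * B) (C / (1 - \<sigma>))"
  have D: "\<sigma> * D + C \<le> D"
  proof -
    have "C / (1 - \<sigma>) \<le> D" by (simp add: D_def)
    then show ?thesis using \<sigma> by (simp add: field_simps)
  qed
  have main: "real n * cmod (err n z) \<le> D" if "z \<in> K" "n \<ge> N" for n z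
    using that(2)
  proof (induction n rule: dec_induct)
    case base
    show ?case using B[OF that(1)] by (simp add: D_def le_max_iff_disj mult_left_mono)
  next
    case (step n)
    have n: "n \<ge> 1" "n \<ge> N0" using step by (auto simp: N_def)
    define w where "w = (z + 1)\<^sup>2 / (4 * z)"
    have w: "cmod w \<le> \<rho>" using \<rho>(3)[OF that(1)] by (simp add: w_def)
    have "0 \<le> D" using step.IH by (meson mult_nonneg_nonneg norm_ge_zero of_nat_0_le_iff order_trans)
    have "0 \<le> C" using C[OF that(1)] norm_ge_zero order_trans by blast
    have "cmod (err (Suc n) z) =
        cmod (of_nat (2 * n + 2) * w * err n z + (1 + z) / 2) / real (2 * n + 1)"
      unfolding err_Suc[OF assms(2)[OF that(1)]] w_def norm_divide norm_of_nat ..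
    also have "\<dots> \<le> (real (2 * n + 2) * \<rho> * cmod (err n z) + C) / real (2 * n + 1)"
    proof (intro divide_right_mono order_trans[OF norm_triangle_ineq] add_mono C that)
      show "cmod (of_nat (2 * n + 2) * w * err n z) \<le> real (2 * n + 2) * \<rho> * cmod (err n z)"
        unfolding norm_mult norm_of_nat using w \<rho>(1) by (intro mult_mono mult_nonneg_nonneg) auto
    qed auto
    finally have "real (n + 1) * cmod (err (Suc n) z) \<le>
        real (n + 1) * ((real (2 * n + 2) * \<rho> * cmod (err n z) + C) / real (2 * n + 1))"
      by (rule mult_left_mono) auto
    \<comment> \<open>Multiplying and dividing by \<open>real n\<close> exposes the quantity bounded
      by the induction hypothesis.\<close>
    also have "\<dots> = \<rho> * (real (n + 1) * real (2 * n + 2) / (real (2 * n + 1) * real n)) * (real n * cmod (err n z))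
        + real (n + 1) / real (2 * n + 1) * C"
    proof -
      have split: "a * ((b * \<rho> * e + C) / d) = \<rho> * (a * b / (d * x)) * (x * e) + a / d * C"
        if "x \<noteq> 0" for a b d e x :: real
        using that by (simp add: add_divide_distrib distrib_left)
      show ?thesis using n by (intro split) simp
    qed
    also have "\<dots> \<le> \<sigma> * D + 1 * C"
      using step.IH N0[OF n(2)] \<open>0 \<le> D\<close> \<open>0 \<le> C\<close> \<sigma> \<rho>(1)
      by (intro add_mono mult_mono) auto
    finally show ?case using D by simp
  qed
  show ?thesis
  proof (rule uniform_limit_zero_comparison[of _ _ "\<lambda>n. D / real n"])
    show "\<forall>\<^sub>F n in sequentially. \<forall>z\<in>K. cmod (err n z) \<le> D / real n"
      using eventually_ge_at_top[of N]
    proof eventually_elim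
      case (elim n)
      then have "n > 0" by (simp add: N_def)
      then show ?case using main elim by (simp add: field_simps)
    qed
  qed real_asymp
qed

section \<open>Central binomial coefficient via Wallis' product\<close>

text \<open>The partial Wallis product \<open>W n\<close> is exactly the reciprocal of
  \<open>(c n)^2 * (2 n + 1)\<close>. The square of the sequence is thus
  \<open>pi * n / ((2 n + 1) * W n)\<close>, with limit \<open>(pi / 2) / (pi / 2)\<close>.\<close>

lemma central_binomial_asymptotics:
  "(\<lambda>n. real (2 * n choose n) * sqrt (pi * real n) / 4 ^ n) \<longlonglongrightarrow> 1"
proof -
  define c where "c n = real (2 * n choose n) / 4 ^ n" for n
  define W where "W n = (\<Prod>k=1..n. (4 * real k ^ 2) / (4 * real k ^ 2 - 1))" for n
  have cs: "c (Suc n) = (2 * real n + 1) / (2 * (real n + 1)) * c n" for n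
  proof -
    have "real (2 * Suc n choose Suc n) = 2 * (2 * real n + 1) * real (2 * n choose n) / (real n + 1)"
      using central_binomial_Suc_real[of n] by (simp only: eq_divide_eq) (simp add: mult.commute)
    then have "c (Suc n) = 2 * (2 * real n + 1) * real (2 * n choose n) / (real n + 1) / (4 * 4 ^ n)"
      by (simp only: c_def power_Suc)
    also have "\<dots> = (2 * real n + 1) / (2 * (real n + 1)) * c n"
      by (simp add: c_def divide_simps) (simp add: algebra_simps)
    finally show ?thesis .
  qed
  have W: "W n * ((c n)\<^sup>2 * (2 * real n + 1)) = 1" for n
  proof (induction n)
    case (Suc n)
    define x where "x = real n"
    have x: "x \<ge> 0" by (simp add: x_def)
    \<comment> \<open>The new denominator factors as
      \<open>4 (x + 1)^2 - 1 = (2 x + 1) (2 x + 3)\<close>.\<close>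
    have "W (Suc n) = W n * (4 * (x + 1)\<^sup>2 / ((2 * x + 1) * (2 * x + 3)))"
      by (simp add: W_def x_def algebra_simps power2_eq_square)
    moreover have "2 * real (Suc n) + 1 = 2 * x + 3" by (simp add: x_def)
    ultimately have "W (Suc n) * ((c (Suc n))\<^sup>2 * (2 * real (Suc n) + 1)) =
        W n * (4 * (x + 1)\<^sup>2 / ((2 * x + 1) * (2 * x + 3))) *
          (((2 * x + 1) / (2 * (x + 1)) * c n)\<^sup>2 * (2 * x + 3))"
      by (simp only: cs x_def[symmetric])
    also have "\<dots> = W n * ((c n)\<^sup>2 * (2 * x + 1))"
      using x by (simp add: divide_simps power2_eq_square) (simp add: algebra_simps)
    finally show ?case using Suc.IH by (simp add: x_def)
  qed (simp add: W_def c_def)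
  have Wnz: "W n \<noteq> 0" for n using W[of n] by auto
  have "(\<lambda>n. real n / (2 * real n + 1)) \<longlonglongrightarrow> 1 / 2" by real_asymp
  moreover have "W \<longlonglongrightarrow> pi / 2" using wallis unfolding W_def .
  ultimately have "(\<lambda>n. pi * (real n / (2 * real n + 1)) / W n) \<longlonglongrightarrow> pi * (1 / 2) / (pi / 2)"
    by (rule tendsto_divide[OF tendsto_mult_left]) simp
  then have "(\<lambda>n. sqrt (pi * (real n / (2 * real n + 1)) / W n)) \<longlonglongrightarrow> sqrt 1"
    by (intro tendsto_real_sqrt) simp
  moreover have "sqrt (pi * (real n / (2 * real n + 1)) / W n) = real (2 * n choose n) * sqrt (pi * real n) / 4 ^ n" for n
  proof -
    have "1 / W n = (c n)\<^sup>2 * (2 * real n + 1)" using W[of n] Wnz[of n] by (simp add: field_simps)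
    moreover have "pi * (real n / (2 * real n + 1)) / W n = pi * (real n / (2 * real n + 1)) * (1 / W n)"
      by simp
    ultimately have "pi * (real n / (2 * real n + 1)) / W n = (c n)\<^sup>2 * (pi * real n)"
      by (simp only:) (simp add: divide_simps)
    then show ?thesis by (simp add: real_sqrt_mult c_def)
  qed
  ultimately show ?thesis by simp
qed

section \<open>Remainders on the two domains\<close>

definition rem_outer :: "nat \<Rightarrow> complex \<Rightarrow> complex" where
  "rem_outer n z = poly (Q n n) z * z ^ n / (z + 1) ^ (2 * n) - 1"

text \<open>Obtained by solving the asserted formula for its \<open>o(1)\<close> term. At
  \<open>n = 0\<close> the square root vanishes and the value is -1, so the formula is recovered
  only for \<open>n \<ge> 1\<close>.\<close>

definition rem_inner :: "nat \<Rightarrow> complex \<Rightarrow> complex" where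
  "rem_inner n z = (1 - z) * poly (Q n n) z * of_real (sqrt (pi * real n)) / 4 ^ n - 1"

lemma E1_nonzero:
  assumes "z \<in> E1"
  shows "z \<noteq> 0" "z + 1 \<noteq> 0"
  using assms by (auto simp: E1_def)

text \<open>Convergence is geometric, with ratio a bound \<open>\<tau> < 1\<close> for
  \<open>cmod (4 * z / (z + 1)^2)\<close> on \<open>K\<close>: the symmetry leaves a correction of
  size at most \<open>M * 4 ^ n\<close>.\<close>

lemma uniform_limit_rem_outer:
  assumes "compact K" "K \<subseteq> E1"
  shows "uniform_limit K rem_outer (\<lambda>z. 0) sequentially"
proof -
  have nz: "z \<noteq> 0" "z + 1 \<noteq> 0" if "z \<in> K" for z using E1_nonzero assms that by blast+
  have cont: "continuous_on K (\<lambda>z. cmod (4 * z / (z + 1)\<^sup>2))" "continuous_on K (\<lambda>z. cmod (1 / z))"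
    by (intro continuous_intros; use nz in simp)+
  have lt1: "cmod (4 * z / (z + 1)\<^sup>2) < 1" if "z \<in> K" for z
  proof -
    have "cmod ((z + 1)\<^sup>2 / (4 * z)) > 1" using assms(2) that by (auto simp: E1_def)
    moreover have "4 * z / (z + 1)\<^sup>2 = inverse ((z + 1)\<^sup>2 / (4 * z))" by simp
    ultimately show ?thesis by (simp only: norm_inverse inverse_less_1_iff) simp
  qed
  obtain \<tau> where \<tau>: "0 \<le> \<tau>" "\<tau> < 1" "\<And>z. z \<in> K \<Longrightarrow> cmod (4 * z / (z + 1)\<^sup>2) \<le> \<tau>"
    by (rule compact_uniformly_less_one[OF assms(1) cont(1) lt1]) (assumption, rule that)
  have lt2: "cmod (1 / z) < 1" if "z \<in> K" for z
  proof -
    have "cmod z > 1" using assms(2) that by (auto simp: E1_def)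
    then show ?thesis unfolding norm_divide norm_one by (subst divide_less_eq_1_pos) auto
  qed
  obtain \<rho> where \<rho>: "0 \<le> \<rho>" "\<rho> < 1" "\<And>z. z \<in> K \<Longrightarrow> cmod (1 / z) \<le> \<rho>"
    by (rule compact_uniformly_less_one[OF assms(1) cont(2) lt2]) (assumption, rule that)
  \<comment> \<open>The numerator bounds \<open>cmod (1 + err n u)\<close> at
    \<open>u = 1 / z\<close>, the denominator bounds \<open>cmod (1 - u)\<close> from below, and the
    final 1 pays for subtracting the central coefficient.\<close>
  define M where "M = (1 + 2 / (1 - \<rho>)\<^sup>2) / (1 - \<rho>) + 1"
  have "cmod (rem_outer n z) \<le> M * \<tau> ^ n" if "z \<in> K" for n z
  proof -
    define u where "u = 1 / z"
    define b where "b = real (2 * n choose n)"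
    have "real (2 * n choose n) \<le> real (2 ^ (2 * n))"
      using binomial_le_pow2[of "2 * n" n] by (simp only: of_nat_le_iff)
    then have b: "0 < b" "b \<le> 4 ^ n" by (auto simp: b_def power_mult)
    have u: "cmod u \<le> \<rho>" using \<rho>(3)[OF that] by (simp add: u_def)
    have u1: "1 - \<rho> \<le> cmod (1 - u)" using norm_triangle_ineq2[of 1 u] u by simp
    have "cmod (err n u) \<le> 2 / (1 - \<rho>)\<^sup>2 / (real n + 1)" by (rule norm_err_disc[OF u \<rho>(2)])
    also have "\<dots> \<le> 2 / (1 - \<rho>)\<^sup>2 / 1" by (intro divide_left_mono) auto
    finally have "cmod (1 + err n u) \<le> 1 + 2 / (1 - \<rho>)\<^sup>2"
      using norm_triangle_ineq[of 1 "err n u"] by simp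
    moreover have "1 + err n u = (1 - u) * poly (Q n n) u / of_real b"
      by (simp add: err_def b_def)
    ultimately have "cmod (1 - u) * cmod (poly (Q n n) u) \<le> (1 + 2 / (1 - \<rho>)\<^sup>2) * b"
      using b by (simp add: norm_mult norm_divide pos_divide_le_eq)
    moreover have "(1 - \<rho>) * cmod (poly (Q n n) u) \<le> cmod (1 - u) * cmod (poly (Q n n) u)"
      using u1 by (rule mult_right_mono) auto
    ultimately have "(1 - \<rho>) * cmod (poly (Q n n) u) \<le> (1 + 2 / (1 - \<rho>)\<^sup>2) * b" by linarith
    then have "cmod (poly (Q n n) u) \<le> (1 + 2 / (1 - \<rho>)\<^sup>2) / (1 - \<rho>) * b"
      using \<rho>(2) by (simp add: pos_le_divide_eq mult.commute)
    then have "cmod (poly (Q n n) u - of_real b) \<le> M * b"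
      using norm_triangle_ineq4[of "poly (Q n n) u" "of_real b"] b
      by (simp add: M_def algebra_simps)
    also have "\<dots> \<le> M * 4 ^ n"
      using b \<rho>(2) by (intro mult_left_mono) (auto simp: M_def)
    finally have p: "cmod (poly (Q n n) u - of_real b) \<le> M * 4 ^ n" .
    have "poly (Q n n) z = (z + 1) ^ (2 * n) / z ^ n - (poly (Q n n) u - of_real b)"
      using poly_Q_inverse[OF nz(1)[OF that], of n] by (simp add: u_def b_def algebra_simps)
    then have "rem_outer n z = - ((poly (Q n n) u - of_real b) * (z / (z + 1)\<^sup>2) ^ n)"
      unfolding rem_outer_def using nz[OF that]
      by (simp add: left_diff_distrib diff_divide_distrib power_mult power_divide)
    then have "cmod (rem_outer n z) = cmod (poly (Q n n) u - of_real b) * cmod (z / (z + 1)\<^sup>2) ^ n"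
      by (simp only: norm_minus_cancel norm_mult norm_power)
    also have "\<dots> \<le> M * 4 ^ n * (\<tau> / 4) ^ n"
    proof (intro mult_mono power_mono)
      have "cmod (4 * z / (z + 1)\<^sup>2) = 4 * cmod (z / (z + 1)\<^sup>2)"
        by (simp add: norm_divide norm_mult)
      then show "cmod (z / (z + 1)\<^sup>2) \<le> \<tau> / 4" using \<tau>(3)[OF that] by simp
    qed (use p \<rho>(2) in \<open>auto simp: M_def\<close>)
    also have "\<dots> = M * \<tau> ^ n" by (simp add: power_divide)
    finally show ?thesis .
  qed
  moreover have "(\<lambda>n. M * \<tau> ^ n) \<longlonglongrightarrow> 0"
    using \<tau> by (intro tendsto_mult_right_zero LIMSEQ_power_zero) auto
  ultimately show ?thesis by (intro uniform_limit_zero_comparison always_eventually) auto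
qed

lemma uniform_limit_err_E2:
  assumes "compact K" "K \<subseteq> E2"
  shows "uniform_limit K err (\<lambda>z. 0) sequentially"
proof -
  \<comment> \<open>\<open>E2\<close> avoids the curve \<open>\<bar>z + 1\<bar>\<^sup>2 = 4 \<bar>z\<bar>\<close>, so the non-strict inequalities give compact
    pieces on which the strict ones hold.\<close>
  define K1 where "K1 = K \<inter> {z. cmod ((z + 1)\<^sup>2) \<le> cmod (4 * z)}"
  define K2 where "K2 = K \<inter> {z. cmod ((z + 1)\<^sup>2) \<ge> cmod (4 * z)}"
  have c: "compact K1" "compact K2" unfolding K1_def K2_def
    by (auto intro!: compact_Int_closed assms closed_Collect_le continuous_intros)
  have "uniform_limit K1 err (\<lambda>z. 0) sequentially"
  proof (rule uniform_limit_err_contraction[OF c(1)])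
    fix z assume z: "z \<in> K1"
    \<comment> \<open>At the origin the inequality defining \<open>K1\<close> would read
      \<open>1 \<le> 0\<close>.\<close>
    then show "z \<noteq> 0" by (auto simp: K1_def)
    with z assms(2) show "cmod ((z + 1)\<^sup>2 / (4 * z)) < 1"
      by (auto simp: K1_def E2_def norm_divide)
  qed
  moreover have "uniform_limit K2 err (\<lambda>z. 0) sequentially"
  proof (rule uniform_limit_err_disc[OF c(2)])
    fix z assume "z \<in> K2"
    with assms(2) show "cmod z < 1"
      by (auto simp: K2_def E2_def norm_divide)
  qed
  moreover have "K = K1 \<union> K2" by (auto simp: K1_def K2_def)
  ultimately show ?thesis by (metis uniform_limit_on_Un)
qed

text \<open>Exactly, \<open>1 + rem_inner n z\<close> is \<open>1 + err n z\<close> times the Wallis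
  factor \<open>\<kappa> n\<close>, which does not depend on \<open>z\<close>; both factors tend to
  1 uniformly.\<close>

lemma uniform_limit_rem_inner:
  assumes "compact K" "K \<subseteq> E2"
  shows "uniform_limit K rem_inner (\<lambda>z. 0) sequentially"
proof -
  define \<kappa> where "\<kappa> n = (of_real (real (2 * n choose n) * sqrt (pi * real n) / 4 ^ n) :: complex)" for n
  have "\<kappa> \<longlonglongrightarrow> of_real 1"
    unfolding \<kappa>_def by (intro tendsto_of_real central_binomial_asymptotics)
  then have "uniform_limit K (\<lambda>n z. \<kappa> n) (\<lambda>z. 1) sequentially"
    by (auto intro!: uniform_limitI dest: tendstoD elim: eventually_mono)
  \<comment> \<open>The product rule for uniform limits needs bounded limit functions; here they are
    constant.\<close>
  then have "uniform_limit K (\<lambda>n z. (1 + err n z) * \<kappa> n - 1) (\<lambda>z. (1 + 0) * 1 - 1) sequentially"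
    by (intro uniform_limit_intros uniform_lim_mult uniform_limit_err_E2 assms)
       (auto simp: image_constant_conv)
  moreover have "rem_inner = (\<lambda>n z. (1 + err n z) * \<kappa> n - 1)"
    by (auto simp: fun_eq_iff rem_inner_def err_def \<kappa>_def)
  ultimately show ?thesis by simp
qed

theorem theorem1:
  shows "(\<exists>r :: nat \<Rightarrow> complex \<Rightarrow> complex.
           (\<forall>n\<ge>1. \<forall>z\<in>E1. poly (Q n n) z = (z + 1) ^ (2 * n) / z ^ n * (1 + r n z)) \<and>
           (\<forall>K. compact K \<longrightarrow> K \<subseteq> E1 \<longrightarrow> uniform_limit K r (\<lambda>z. 0) sequentially)) \<and>
         (\<exists>r :: nat \<Rightarrow> complex \<Rightarrow> complex.
           (\<forall>n\<ge>1. \<forall>z\<in>E2. poly (Q n n) z =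
              2 ^ (2 * n) / (of_real (sqrt (pi * real n)) * (1 - z)) * (1 + r n z)) \<and>
           (\<forall>K. compact K \<longrightarrow> K \<subseteq> E2 \<longrightarrow> uniform_limit K r (\<lambda>z. 0) sequentially))"
proof (rule conjI)
  have "poly (Q n n) z = (z + 1) ^ (2 * n) / z ^ n * (1 + rem_outer n z)" if "z \<in> E1" for n z
    using E1_nonzero[OF that] by (simp add: rem_outer_def)
  then show "\<exists>r. (\<forall>n\<ge>1. \<forall>z\<in>E1. poly (Q n n) z = (z + 1) ^ (2 * n) / z ^ n * (1 + r n z)) \<and>
      (\<forall>K. compact K \<longrightarrow> K \<subseteq> E1 \<longrightarrow> uniform_limit K r (\<lambda>z. 0) sequentially)"
    using uniform_limit_rem_outer by blast
next
  have "poly (Q n n) z = 2 ^ (2 * n) / (of_real (sqrt (pi * real n)) * (1 - z)) * (1 + rem_inner n z)"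
    if "n \<ge> 1" "z \<in> E2" for n z
  proof -
    \<comment> \<open>The point 1 has \<open>(z + 1)^2 / (4 z) = 1\<close>, so it lies on the
      excluded curve.\<close>
    have "z \<noteq> 1" using that by (auto simp: E2_def)
    then show ?thesis using that by (simp add: rem_inner_def power_mult)
  qed
  then show "\<exists>r. (\<forall>n\<ge>1. \<forall>z\<in>E2. poly (Q n n) z =
        2 ^ (2 * n) / (of_real (sqrt (pi * real n)) * (1 - z)) * (1 + r n z)) \<and>
      (\<forall>K. compact K \<longrightarrow> K \<subseteq> E2 \<longrightarrow> uniform_limit K r (\<lambda>z. 0) sequentially)"
    using uniform_limit_rem_inner by blast
qed

end
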